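(* Let $(\mathcal S,\mathcal A,P,r)$ be a weakly communicating MDP and let $(g^\star,h^\star)$ be a solution of the modified Bellman equations. Let $f:\mathbb R^n\to\mathbb R$ be continuous with $f(x+c\mathbf 1)=f(x)+c$ for all $x\in\mathbb R^n$, $c\in\mathbb R$. Let $h^0\in\mathbb R^n$ and for $k\ge1$ \[h^k=\tfrac12 h^{k-1}+\tfrac12\big(Th^{k-1}-f(h^{k-1})\mathbf 1\big)\] (Relaxed Relative Value Iteration with $\lambda_k=1/2$), and let $\pi_k$ be a greedy policy, $T^{\pi_k}h^k=Th^k$. Then for $k\ge1$, \[\|g^\star-g^{\pi_k}\|_\infty\le\|Th^k-h^k-g^\star\|_\infty\le\frac{4}{\sqrt{\varpi k}}\|h^0-h^\star\|_\infty,\] where $\varpi=3.141592\ldots$ is the circle constant. Furthermore, $h^k\to h^\infty$ and $f(h^k)\mathbf 1\to g^\star$ for some solution $(g^\star,h^\infty)$ of the modified Bellman equations.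
   Context: An MDP $(\mathcal S,\mathcal A,P,r)$ has finite state space $\mathcal S$ ($|\mathcal S|=n$, functions identified with $\mathbb R^n$), finite action space, transition probabilities $P(s'\mid s,a)$ and bounded reward $r$. For a policy $\pi$: $r^\pi(s)=\sum_a\pi(a\mid s)r(s,a)$, $\mathcal P^\pi(s,s')=\sum_a\pi(a\mid s)P(s'\mid s,a)$, $g^\pi(s)=\liminf_{T\to\infty}\frac1T\mathbb E_\pi[\sum_{t=0}^{T-1}r(s_t,a_t)\mid s_0=s]$, $g^\star=\max_\pi g^\pi$ (pointwise). $T^\pi V=r^\pi+\mathcal P^\pi V$, $(TV)(s)=\max_a\{r(s,a)+\sum_{s'}P(s'\mid s,a)V(s')\}$. $\mathbf 1$ is the all-ones vector. A pair $(g,h)$ solves the modified Bellman equations if $\max_a\sum_{s'}P(s'\mid s,a)g(s')=g(s)$ and $\max_a\{r(s,a)+\sum_{s'}P(s'\mid s,a)h(s')\}=h(s)+g(s)$ for all $s$, with some policy attaining both maxima simultaneously; the first component of any solution equals $g^\star$. An MDP is weakly communicating if there is a closed set of states such that each state in it is accessible from every other state in it under some deterministic policy, plus a possibly empty set of states that is transient under every policy. *)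

theory Defs
  imports "HOL-Analysis.Analysis"
begin

text \<open>Finite MDP: states type 's, actions type 'a (both finite).
  Transition kernel P s a s' = P(s'|s,a), reward r s a.
  Vectors in R^n are functions 's => real.\<close>

definition is_mdp :: "('s::finite \<Rightarrow> 'a::finite \<Rightarrow> 's \<Rightarrow> real) \<Rightarrow> bool" where
  "is_mdp P \<longleftrightarrow> (\<forall>s a. (\<forall>s'. P s a s' \<ge> 0) \<and> (\<Sum>s'\<in>UNIV. P s a s') = 1)"

definition policies :: "('s \<Rightarrow> 'a::finite \<Rightarrow> real) set" where
  "policies = {\<pi>. \<forall>s. (\<forall>a. \<pi> s a \<ge> 0) \<and> (\<Sum>a\<in>UNIV. \<pi> s a) = 1}"

definition det_pol :: "('s \<Rightarrow> 'a) \<Rightarrow> 's \<Rightarrow> 'a \<Rightarrow> real" where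
  "det_pol d = (\<lambda>s a. if a = d s then 1 else 0)"

definition r_pol :: "('s \<Rightarrow> 'a::finite \<Rightarrow> real) \<Rightarrow> ('s \<Rightarrow> 'a \<Rightarrow> real) \<Rightarrow> 's \<Rightarrow> real" where
  "r_pol r \<pi> s = (\<Sum>a\<in>UNIV. \<pi> s a * r s a)"

definition P_pol :: "('s::finite \<Rightarrow> 'a::finite \<Rightarrow> 's \<Rightarrow> real) \<Rightarrow> ('s \<Rightarrow> 'a \<Rightarrow> real) \<Rightarrow> 's \<Rightarrow> 's \<Rightarrow> real" where
  "P_pol P \<pi> s s' = (\<Sum>a\<in>UNIV. \<pi> s a * P s a s')"

fun mpow :: "('s::finite \<Rightarrow> 's \<Rightarrow> real) \<Rightarrow> nat \<Rightarrow> 's \<Rightarrow> 's \<Rightarrow> real" where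
  "mpow M 0 = (\<lambda>s s'. if s = s' then 1 else 0)"
| "mpow M (Suc t) = (\<lambda>s s'. \<Sum>u\<in>UNIV. M s u * mpow M t u s')"

definition mvec :: "('s::finite \<Rightarrow> 's \<Rightarrow> real) \<Rightarrow> ('s \<Rightarrow> real) \<Rightarrow> 's \<Rightarrow> real" where
  "mvec M v s = (\<Sum>s'\<in>UNIV. M s s' * v s')"

text \<open>Gain of a policy: g^pi(s) = liminf_T (1/T) E_pi[sum_{t<T} r(s_t,a_t) | s_0 = s],
  where for a stationary policy E_pi[r(s_t,a_t)|s_0=s] = ((P^pi)^t r^pi)(s).\<close>
definition gain :: "('s::finite \<Rightarrow> 'a::finite \<Rightarrow> 's \<Rightarrow> real) \<Rightarrow> ('s \<Rightarrow> 'a \<Rightarrow> real)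
    \<Rightarrow> ('s \<Rightarrow> 'a \<Rightarrow> real) \<Rightarrow> 's \<Rightarrow> real" where
  "gain P r \<pi> s = real_of_ereal (liminf (\<lambda>T. ereal (1 / real T *
      (\<Sum>t<T. mvec (mpow (P_pol P \<pi>) t) (r_pol r \<pi>) s))))"

definition opt_gain :: "('s::finite \<Rightarrow> 'a::finite \<Rightarrow> 's \<Rightarrow> real) \<Rightarrow> ('s \<Rightarrow> 'a \<Rightarrow> real) \<Rightarrow> 's \<Rightarrow> real" where
  "opt_gain P r s = (SUP \<pi>\<in>policies. gain P r \<pi> s)"

definition T_pol :: "('s::finite \<Rightarrow> 'a::finite \<Rightarrow> 's \<Rightarrow> real) \<Rightarrow> ('s \<Rightarrow> 'a \<Rightarrow> real)
    \<Rightarrow> ('s \<Rightarrow> 'a \<Rightarrow> real) \<Rightarrow> ('s \<Rightarrow> real) \<Rightarrow> 's \<Rightarrow> real" where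
  "T_pol P r \<pi> V = (\<lambda>s. r_pol r \<pi> s + mvec (P_pol P \<pi>) V s)"

definition T_bell :: "('s::finite \<Rightarrow> 'a::finite \<Rightarrow> 's \<Rightarrow> real) \<Rightarrow> ('s \<Rightarrow> 'a \<Rightarrow> real)
    \<Rightarrow> ('s \<Rightarrow> real) \<Rightarrow> 's \<Rightarrow> real" where
  "T_bell P r V = (\<lambda>s. Max (range (\<lambda>a. r s a + (\<Sum>s'\<in>UNIV. P s a s' * V s'))))"

definition mod_bellman :: "('s::finite \<Rightarrow> 'a::finite \<Rightarrow> 's \<Rightarrow> real) \<Rightarrow> ('s \<Rightarrow> 'a \<Rightarrow> real)
    \<Rightarrow> ('s \<Rightarrow> real) \<Rightarrow> ('s \<Rightarrow> real) \<Rightarrow> bool" where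
  "mod_bellman P r g h \<longleftrightarrow>
     (\<forall>s. Max (range (\<lambda>a. \<Sum>s'\<in>UNIV. P s a s' * g s')) = g s) \<and>
     (\<forall>s. Max (range (\<lambda>a. r s a + (\<Sum>s'\<in>UNIV. P s a s' * h s'))) = h s + g s) \<and>
     (\<exists>\<pi>\<in>policies. \<forall>s. mvec (P_pol P \<pi>) g s = g s \<and> T_pol P r \<pi> h s = h s + g s)"

text \<open>Transience of a state in a finite Markov chain with matrix M:
  finite expected number of visits, sum_t M^t(s,s) < infinity.\<close>
definition transient :: "('s::finite \<Rightarrow> 's \<Rightarrow> real) \<Rightarrow> 's \<Rightarrow> bool" where
  "transient M s \<longleftrightarrow> summable (\<lambda>t. mpow M t s s)"

definition weakly_communicating :: "('s::finite \<Rightarrow> 'a::finite \<Rightarrow> 's \<Rightarrow> real) \<Rightarrow> bool" where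
  "weakly_communicating P \<longleftrightarrow> (\<exists>C.
     (\<forall>s\<in>C. \<forall>a s'. P s a s' > 0 \<longrightarrow> s' \<in> C) \<and>
     (\<forall>s\<in>C. \<forall>s'\<in>C. \<exists>d. \<exists>t. mpow (P_pol P (det_pol d)) t s s' > 0) \<and>
     (\<forall>s. s \<notin> C \<longrightarrow> (\<forall>\<pi>\<in>policies. transient (P_pol P \<pi>) s)))"

definition supn :: "('s::finite \<Rightarrow> real) \<Rightarrow> real" where
  "supn v = Max (range (\<lambda>s. \<bar>v s\<bar>))"

end

(* After a shift of h^k by a scalar, the iteration becomes x' = (x + F x) / 2 with F = T - g*, a
   map that is nonexpansive in the supremum norm: g* is constant because the MDP is weakly
   communicating, and F fixes h*. For such iterations an induction on m bounds |x_m - x_n|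
   by 2 d times the tail m < j <= n of the Binomial(m + n, 1/2) weights, where d is the initial
   distance to h*. At n = m + 1 this is a normalized central binomial coefficient, which Wallis' product bounds
   by 1 / sqrt(pi k). Compactness and monotonicity of the distance to fixed points
   give convergence, and the scalar shifts follow a contracting recursion. The gain of a greedy
   policy is compared with g* by telescoping the average reward. *)
theory Submission
  imports Defs "HOL-Real_Asymp.Real_Asymp"
begin

section \<open>The central binomial coefficient\<close>

text \<open>The duplication formula \<open>(2n)! = 4^n (1/2)_n n!\<close>. In Pochhammer form the
  passage from \<open>n\<close> to \<open>Suc n\<close> is multiplication by a single
  factor.\<close>

lemma central_binomial_pochhammer:
  "real (2 * n choose n) / 4 ^ n = pochhammer (1/2) n / fact n"
proof -
  have "real (2 * n choose n) = fact (2 * n) / (fact n * fact (2 * n - n))"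
    by (rule binomial_fact) simp
  also have "\<dots> = 2 ^ (2 * n) * pochhammer (1/2) n * fact n / (fact n * fact n)"
    by (simp add: fact_double)
  finally show ?thesis
    by (simp add: power_mult)
qed

text \<open>An exact identity with the partial Wallis products, through which their limit
  \<open>pi / 2\<close> reaches the central binomial coefficients. It holds by induction because the
  factors gained in each step cancel.\<close>

lemma wallis_central_binomial:
  "(\<Prod>k=1..n. (4 * real k ^ 2) / (4 * real k ^ 2 - 1)) *
     (real (2 * n choose n) / 4 ^ n) ^ 2 * (2 * real n + 1) = 1"
  unfolding central_binomial_pochhammer
proof (induction n)
  case (Suc n)
  define w where "w = (\<Prod>k=1..n. (4 * real k ^ 2) / (4 * real k ^ 2 - 1))"
  define b where "b = (pochhammer (1/2) n / fact n :: real)"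
  have IH: "w * b ^ 2 * (2 * real n + 1) = 1"
    using Suc unfolding w_def b_def .
  have b': "pochhammer (1/2) (Suc n) / fact (Suc n) = b * ((2 * real n + 1) / (2 * (real n + 1)))"
    by (simp add: b_def pochhammer_Suc field_simps)
  have sq: "4 * (real (Suc n))\<^sup>2 - 1 = (2 * real n + 1) * (2 * real n + 3)"
    by (simp add: power2_eq_square algebra_simps)
  have w': "(\<Prod>k=1..Suc n. (4 * real k ^ 2) / (4 * real k ^ 2 - 1)) =
      w * (4 * (real n + 1) ^ 2 / ((2 * real n + 1) * (2 * real n + 3)))"
    by (simp add: w_def sq[simplified] add.commute)
  \<comment> \<open>Here \<open>x\<close> stands for \<open>2n + 1\<close> and \<open>y\<close> for
    \<open>n + 1\<close>. The new Wallis factor times the squared ratio of \<open>b\<close> is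
    \<open>x / (x + 2)\<close>, which the change of the last factor from \<open>x\<close> to
    \<open>x + 2\<close> undoes.\<close>
  have "w * (4 * y ^ 2 / (x * (x + 2))) * (b * (x / (2 * y))) ^ 2 * (x + 2) = w * b ^ 2 * x"
    if "x > 0" "y > 0" for x y :: real
    using that by (simp add: power2_eq_square divide_simps)
  from this[of "2 * real n + 1" "real n + 1"]
  have "w * (4 * (real n + 1) ^ 2 / ((2 * real n + 1) * (2 * real n + 3))) *
      (b * ((2 * real n + 1) / (2 * (real n + 1)))) ^ 2 * (2 * real (Suc n) + 1)
      = w * b ^ 2 * (2 * real n + 1)"
    by (simp add: add.commute)
  then show ?case
    unfolding b' w' by (simp only: IH)
qed simp

text \<open>The sequence \<open>n b_n^2\<close> is increasing, since
  \<open>4n(n + 1) \<le> (2n + 1)^2\<close>, and by Wallis it tends to \<open>1 / pi\<close>, so it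
  never exceeds that limit.\<close>

lemma central_binomial_le:
  assumes "n > 0"
  shows "real (2 * n choose n) / 4 ^ n \<le> 1 / sqrt (pi * real n)"
proof -
  define b where "b = (\<lambda>n. real (2 * n choose n) / 4 ^ n)"
  define w where "w = (\<lambda>n. \<Prod>k=1..n. (4 * real k ^ 2) / (4 * real k ^ 2 - 1))"
  have wb: "w n * b n ^ 2 * (2 * real n + 1) = 1" for n
    unfolding w_def b_def by (rule wallis_central_binomial)
  have b_nonneg: "b n \<ge> 0" for n
    by (simp add: b_def)
  have b_Suc: "b (Suc n) = b n * ((2 * real n + 1) / (2 * (real n + 1)))" for n
    unfolding b_def central_binomial_pochhammer by (simp add: pochhammer_Suc field_simps)
  have "incseq (\<lambda>n. real n * b n ^ 2)"
  proof (rule incseq_SucI)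
    fix n
    have "real n \<le> (real n + 1) * ((2 * real n + 1) / (2 * (real n + 1))) ^ 2"
      by (simp add: power2_eq_square divide_simps) (simp add: algebra_simps)
    then have "real n * b n ^ 2 \<le> (real n + 1) * ((2 * real n + 1) / (2 * (real n + 1))) ^ 2 * b n ^ 2"
      by (rule mult_right_mono) simp
    then show "real n * b n ^ 2 \<le> real (Suc n) * b (Suc n) ^ 2"
      unfolding b_Suc by (simp only: power_mult_distrib of_nat_Suc ac_simps)
  qed
  moreover have "(\<lambda>n. real n * b n ^ 2) \<longlonglongrightarrow> 1 / pi"
  proof -
    have "(\<lambda>n. real n / (2 * real n + 1)) \<longlonglongrightarrow> 1 / 2"
      by real_asymp
    then have "(\<lambda>n. real n / (2 * real n + 1) / w n) \<longlonglongrightarrow> 1 / 2 / (pi / 2)"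
      unfolding w_def by (rule tendsto_divide[OF _ wallis]) simp
    moreover have "real n / (2 * real n + 1) / w n = real n * b n ^ 2" for n
    proof -
      have "w n \<noteq> 0" "2 * real n + 1 \<noteq> 0"
        using wb[of n] by auto
      then show ?thesis
        using wb[of n] by (simp add: divide_simps) (simp add: algebra_simps)
    qed
    ultimately show ?thesis
      by simp
  qed
  ultimately have "real n * b n ^ 2 \<le> 1 / pi"
    by (rule incseq_le)
  then have "b n ^ 2 \<le> 1 / (pi * real n)"
    using assms by (simp add: field_simps)
  then have "sqrt (b n ^ 2) \<le> sqrt (1 / (pi * real n))"
    by (rule real_sqrt_le_mono)
  then show ?thesis
    using b_nonneg[of n] by (simp add: b_def real_sqrt_divide)
qed

section \<open>Averaged iterations of nonexpansive maps in the supremum norm\<close>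

definition sup_nonexpansive :: "(('s \<Rightarrow> real) \<Rightarrow> 's \<Rightarrow> real) \<Rightarrow> bool" where
  "sup_nonexpansive F \<longleftrightarrow>
     (\<forall>u v c. (\<forall>s. \<bar>u s - v s\<bar> \<le> c) \<longrightarrow> (\<forall>s. \<bar>F u s - F v s\<bar> \<le> c))"

lemma sup_nonexpansiveD:
  "sup_nonexpansive F \<Longrightarrow> (\<And>s. \<bar>u s - v s\<bar> \<le> c) \<Longrightarrow> \<bar>F u s - F v s\<bar> \<le> c"
  unfolding sup_nonexpansive_def by blast

text \<open>The probability that a Binomial(\<open>m + n\<close>, 1/2) variable lies in
  \<open>{m<..n}\<close>. These weights solve with equality the recursion that averaging and
  nonexpansiveness give for the distances between iterates.\<close>

definition km_bound :: "nat \<Rightarrow> nat \<Rightarrow> real" where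
  "km_bound m n = real (\<Sum>j\<in>{m<..n}. (m + n) choose j) / 2 ^ (m + n)"

lemma km_bound_same [simp]: "km_bound m m = 0"
  by (simp add: km_bound_def)

text \<open>For \<open>m = 0\<close> the weight is \<open>1 - 2^(-n)\<close>. The value 1 matches
  the crude bound \<open>2 * d\<close> that starts the induction on \<open>m\<close>.\<close>

lemma km_bound_0_Suc: "2 * km_bound 0 (Suc n) - km_bound 0 n = 1"
proof -
  have "real (\<Sum>j\<in>{0<..n}. n choose j) = 2 ^ n - 1" for n
  proof -
    have "{..n} = insert 0 {0<..n}"
      by auto
    then have "(\<Sum>j\<le>n. n choose j) = 1 + (\<Sum>j\<in>{0<..n}. n choose j)"
      by simp
    then have "real (\<Sum>j\<in>{0<..n}. n choose j) = real (2 ^ n) - 1"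
      by (simp add: choose_row_sum)
    then show ?thesis
      by simp
  qed
  then have *: "km_bound 0 n = (2 ^ n - 1) / 2 ^ n" for n
    by (simp add: km_bound_def)
  show ?thesis
    unfolding * by (simp add: field_simps)
qed

text \<open>Pascal's rule for row \<open>m + n + 2\<close>, after which the term at
  \<open>Suc n\<close> moves from one sum to the other. At \<open>m = n\<close> the identity fails:
  the left side is 0 and the right side positive.\<close>

lemma km_bound_Suc_Suc:
  assumes "m < n"
  shows "2 * km_bound (Suc m) (Suc n) - km_bound (Suc m) n = km_bound m (Suc n)"
proof -
  let ?N = "Suc (m + n)"
  have "(\<Sum>j\<in>{Suc m<..Suc n}. Suc ?N choose j) = (\<Sum>i\<in>{m<..n}. Suc ?N choose Suc i)"
    by (rule sum.reindex_bij_witness[of _ Suc "\<lambda>j. j - 1"]) auto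
  also have "\<dots> = (\<Sum>i\<in>{m<..n}. ?N choose i) + (\<Sum>i\<in>{m<..n}. ?N choose Suc i)"
    by (simp add: sum.distrib)
  also have "(\<Sum>i\<in>{m<..n}. ?N choose Suc i) = (\<Sum>j\<in>{Suc m<..Suc n}. ?N choose j)"
    by (rule sum.reindex_bij_witness[of _ "\<lambda>j. j - 1" Suc]) auto
  also have "(\<Sum>i\<in>{m<..n}. ?N choose i) + (\<Sum>j\<in>{Suc m<..Suc n}. ?N choose j)
      = (\<Sum>i\<in>{m<..Suc n}. ?N choose i) + (\<Sum>j\<in>{Suc m<..n}. ?N choose j)"
  proof -
    have "{m<..Suc n} = insert (Suc n) {m<..n}" "{Suc m<..Suc n} = insert (Suc n) {Suc m<..n}"
      using assms by auto
    then show ?thesis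
      by simp
  qed
  finally have *: "real (\<Sum>j\<in>{Suc m<..Suc n}. Suc ?N choose j) =
      real (\<Sum>i\<in>{m<..Suc n}. ?N choose i) + real (\<Sum>j\<in>{Suc m<..n}. ?N choose j)"
    by (simp only: of_nat_add)
  show ?thesis
    unfolding km_bound_def using *
    by (simp only: add_Suc add_Suc_right power_Suc) (simp add: field_simps)
qed

text \<open>A single binomial coefficient is left in the weight, and \<open>C(2k + 2, k + 1)\<close>
  is twice \<open>C(2k + 1, k + 1)\<close>.\<close>

lemma km_bound_adjacent:
  "2 * km_bound k (Suc k) = 2 * (real (2 * Suc k choose Suc k) / 4 ^ Suc k)"
proof -
  have "{k<..Suc k} = {Suc k}"
    by auto
  moreover have "2 * Suc k choose Suc k = 2 * (Suc (2 * k) choose Suc k)"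
    using central_binomial_odd[of "Suc (2 * k)"]
    by simp
  moreover have "(4::real) ^ k = 2 ^ (2 * k)"
    by (simp add: power_mult)
  ultimately show ?thesis
    unfolding km_bound_def by (simp del: binomial_Suc_Suc add: mult_2[symmetric])
qed

text \<open>The Krasnoselskii-Mann iteration with weight 1/2. The point \<open>p\<close> is a
  reference fixed point and \<open>d\<close> any bound on the initial distance to it.\<close>

locale km_iteration =
  fixes F :: "('s::finite \<Rightarrow> real) \<Rightarrow> 's \<Rightarrow> real"
    and x :: "nat \<Rightarrow> 's \<Rightarrow> real"
    and p :: "'s \<Rightarrow> real"
    and d :: real
  assumes nonexp: "sup_nonexpansive F"
    and fixp: "F p = p"
    and step: "x (Suc k) s = (x k s + F (x k) s) / 2"
    and start: "\<bar>x 0 s - p s\<bar> \<le> d"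
begin

text \<open>Stated for an arbitrary fixed point \<open>q\<close>, since it is applied both to
  \<open>p\<close> and to the limit of a subsequence.\<close>

lemma step_fixpoint_dist:
  assumes "F q = q" "\<And>s. \<bar>x k s - q s\<bar> \<le> c"
  shows "\<bar>x (Suc k) s - q s\<bar> \<le> c"
proof -
  have "\<bar>F (x k) s - F q s\<bar> \<le> c"
    by (rule sup_nonexpansiveD[OF nonexp]) (rule assms(2))
  then show ?thesis
    using assms(2)[of s] unfolding step assms(1) by (auto simp: abs_le_iff field_simps)
qed

lemma dist_fixpoint: "\<bar>x k s - p s\<bar> \<le> d"
proof (induction k arbitrary: s)
  case (Suc k)
  then show ?case
    using step_fixpoint_dist[OF fixp] by blast
qed (rule start)

lemma dist_image: "\<bar>x m s - F (x n) s\<bar> \<le> 2 * d"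
proof -
  have "\<bar>F (x n) s - F p s\<bar> \<le> d"
    by (rule sup_nonexpansiveD[OF nonexp]) (rule dist_fixpoint)
  then show ?thesis
    using dist_fixpoint[of m s] unfolding fixp by linarith
qed

lemma dist_Suc_right:
  assumes "\<bar>x m s - x n s\<bar> \<le> a" "\<bar>x m s - F (x n) s\<bar> \<le> b"
  shows "\<bar>x m s - x (Suc n) s\<bar> \<le> (a + b) / 2"
  unfolding step using assms by (auto simp: abs_le_iff field_simps)

text \<open>The iterate \<open>x (Suc m)\<close> is the midpoint of \<open>x m\<close> and
  \<open>F (x m)\<close>, and nonexpansiveness bounds the distance from \<open>F (x m)\<close> to
  \<open>F (x n)\<close> by that of the iterates.\<close>

lemma dist_Suc_left:
  assumes "\<And>s. \<bar>x m s - x n s\<bar> \<le> a" "\<bar>x m s - F (x n) s\<bar> \<le> b"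
  shows "\<bar>x (Suc m) s - F (x n) s\<bar> \<le> (a + b) / 2"
proof -
  have "\<bar>F (x m) s - F (x n) s\<bar> \<le> a"
    by (rule sup_nonexpansiveD[OF nonexp]) (rule assms(1))
  then show ?thesis
    using assms(2) unfolding step by (auto simp: abs_le_iff field_simps)
qed

text \<open>Induction on \<open>n\<close> from \<open>n = m\<close>, where both sides vanish. The
  bound assumed for the image is the one whose average with \<open>km_bound m n\<close> is
  \<open>km_bound m (Suc n)\<close>.\<close>

lemma dist_le_of_image:
  assumes "\<And>n s. n \<ge> m \<Longrightarrow>
      \<bar>x m s - F (x n) s\<bar> \<le> 2 * d * (2 * km_bound m (Suc n) - km_bound m n)"
    and "n \<ge> m"
  shows "\<bar>x m s - x n s\<bar> \<le> 2 * d * km_bound m n"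
  using assms(2)
proof (induction n rule: dec_induct)
  case (step n)
  from dist_Suc_right[OF step.IH assms(1)[OF step.hyps(1)]]
  show ?case
    by (simp add: algebra_simps)
qed simp

lemma dist_bounds:
  assumes "n \<ge> m"
  shows "\<bar>x m s - x n s\<bar> \<le> 2 * d * km_bound m n"
    and "\<bar>x m s - F (x n) s\<bar> \<le> 2 * d * (2 * km_bound m (Suc n) - km_bound m n)"
proof -
  \<comment> \<open>The induction carries only the image bound; the distance bound at the same
    \<open>m\<close> follows from it. Averaging the two gives \<open>km_bound m (Suc n)\<close>,
    which \<open>km_bound_Suc_Suc\<close> rewrites as the image weight for
    \<open>Suc m\<close>.\<close>
  have "\<forall>n\<ge>m. \<forall>s. \<bar>x m s - F (x n) s\<bar> \<le> 2 * d * (2 * km_bound m (Suc n) - km_bound m n)"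
  proof (induction m)
    case 0
    then show ?case
      using dist_image km_bound_0_Suc by simp
  next
    case (Suc m)
    show ?case
    proof (intro allI impI)
      fix n s
      assume n: "n \<ge> Suc m"
      then have "\<bar>x m s - x n s\<bar> \<le> 2 * d * km_bound m n" for s
        using Suc by (intro dist_le_of_image) auto
      from dist_Suc_left[OF this, of s "2 * d * (2 * km_bound m (Suc n) - km_bound m n)"]
      have "\<bar>x (Suc m) s - F (x n) s\<bar> \<le> 2 * d * km_bound m (Suc n)"
        using Suc n by (simp add: algebra_simps)
      then show "\<bar>x (Suc m) s - F (x n) s\<bar> \<le>
          2 * d * (2 * km_bound (Suc m) (Suc n) - km_bound (Suc m) n)"
        using km_bound_Suc_Suc[of m n] n by simp
    qed
  qed
  then show "\<bar>x m s - F (x n) s\<bar> \<le> 2 * d * (2 * km_bound m (Suc n) - km_bound m n)"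
    and "\<bar>x m s - x n s\<bar> \<le> 2 * d * km_bound m n"
    using assms by (auto intro!: dist_le_of_image)
qed

lemma d_nonneg: "d \<ge> 0"
  using start abs_ge_zero order_trans by blast

lemma residual_le:
  assumes "k > 0"
  shows "\<bar>F (x k) s - x k s\<bar> \<le> 4 / sqrt (pi * real k) * d"
proof -
  have "\<bar>F (x k) s - x k s\<bar> \<le> 2 * d * (2 * km_bound k (Suc k))"
    \<comment> \<open>On the diagonal the subtracted weight \<open>km_bound k k\<close> is
      0.\<close>
    using dist_bounds(2)[of k k s] by (simp add: abs_minus_commute)
  also have "\<dots> = 4 * d * (real (2 * Suc k choose Suc k) / 4 ^ Suc k)"
    by (simp only: km_bound_adjacent)
  also have "\<dots> \<le> 4 * d * (1 / sqrt (pi * real (Suc k)))"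
    using d_nonneg by (intro mult_left_mono central_binomial_le) auto
  \<comment> \<open>Positivity of \<open>k\<close> matters: at \<open>k = 0\<close> the convention
    \<open>1 / 0 = 0\<close> would make the right side 0.\<close>
  also have "\<dots> \<le> 4 * d * (1 / sqrt (pi * real k))"
    using d_nonneg assms by (intro mult_left_mono divide_left_mono) auto
  finally show ?thesis
    by (simp add: mult.commute)
qed

lemma residual_tendsto_0: "(\<lambda>k. F (x k) s - x k s) \<longlonglongrightarrow> 0"
proof (rule tendsto_0_le)
  show "(\<lambda>k. 4 / sqrt (pi * real k) * d) \<longlonglongrightarrow> 0"
    by real_asymp
  show "\<forall>\<^sub>F k in sequentially.
      norm (F (x k) s - x k s) \<le> norm (4 / sqrt (pi * real k) * d) * 1"
    using eventually_gt_at_top[of 0]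
  proof eventually_elim
    case (elim k)
    then show ?case
      using residual_le[of k s] d_nonneg by (simp add: abs_mult)
  qed
qed

lemma converges_to_fixpoint:
  obtains q where "F q = q" "\<And>s. (\<lambda>k. x k s) \<longlonglongrightarrow> q s"
proof -
  \<comment> \<open>Viewed in the Euclidean space \<open>real ^ 's\<close>, the bounded iterates
    have a convergent subsequence by Bolzano-Weierstrass.\<close>
  define y :: "nat \<Rightarrow> real ^ 's" where "y = (\<lambda>k. \<chi> s. x k s)"
  have "bounded (range y)"
    unfolding bounded_iff
  proof (intro exI ballI)
    fix z
    assume "z \<in> range y"
    then obtain k where z: "z = y k"
      by blast
    have "norm z \<le> (\<Sum>s\<in>UNIV. \<bar>z $ s\<bar>)"
      by (rule norm_le_l1_cart)
    also have "\<dots> \<le> (\<Sum>s\<in>UNIV. d + \<bar>p s\<bar>)"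
    proof (rule sum_mono)
      show "\<bar>z $ s\<bar> \<le> d + \<bar>p s\<bar>" for s
        using dist_fixpoint[of k s] by (simp add: z y_def)
    qed
    finally show "norm z \<le> (\<Sum>s\<in>UNIV. d + \<bar>p s\<bar>)" .
  qed
  then obtain l \<phi> where \<phi>: "strict_mono \<phi>" and l: "(y \<circ> \<phi>) \<longlonglongrightarrow> l"
    using bounded_imp_convergent_subsequence by blast
  define q where "q = (\<lambda>s. l $ s)"
  have sub: "(\<lambda>k. x (\<phi> k) s) \<longlonglongrightarrow> q s" for s
    using tendsto_vec_nth[OF l, of s] by (simp add: y_def q_def)
  \<comment> \<open>Nonexpansiveness needs one bound for all coordinates; finiteness of the state
    space makes the coordinatewise limits uniform.\<close>
  have close: "\<forall>\<^sub>F k in sequentially. \<forall>s. \<bar>x (\<phi> k) s - q s\<bar> \<le> e / 2"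
    if "e > 0" for e :: real
  proof (rule eventually_all_finite)
    have "e / 2 > 0"
      using that by simp
    then show "\<forall>\<^sub>F k in sequentially. \<bar>x (\<phi> k) s - q s\<bar> \<le> e / 2" for s
      using tendstoD[OF sub, of "e / 2" s] by (auto elim!: eventually_mono simp: dist_real_def)
  qed
  have "F q s = q s" for s
  proof -
    have "(\<lambda>k. F (x (\<phi> k)) s) \<longlonglongrightarrow> F q s"
    proof (rule LIMSEQ_I)
      fix e :: real
      assume e: "e > 0"
      from close[OF e]
      have "\<forall>\<^sub>F k in sequentially. norm (F (x (\<phi> k)) s - F q s) < e"
      proof eventually_elim
        case (elim k)
        then have "\<bar>F (x (\<phi> k)) s - F q s\<bar> \<le> e / 2"
          by (intro sup_nonexpansiveD[OF nonexp]) auto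
        then show ?case
          using e by simp
      qed
      then show "\<exists>no. \<forall>k\<ge>no. norm (F (x (\<phi> k)) s - F q s) < e"
        by (simp add: eventually_sequentially)
    qed
    then have "(\<lambda>k. F (x (\<phi> k)) s - x (\<phi> k) s) \<longlonglongrightarrow> F q s - q s"
      by (intro tendsto_diff sub)
    moreover have "(\<lambda>k. F (x (\<phi> k)) s - x (\<phi> k) s) \<longlonglongrightarrow> 0"
      using LIMSEQ_subseq_LIMSEQ[OF residual_tendsto_0 \<phi>, of s] by (simp add: o_def)
    ultimately show ?thesis
      using LIMSEQ_unique by fastforce
  qed
  then have q: "F q = q"
    by (rule ext)
  have "(\<lambda>k. x k s) \<longlonglongrightarrow> q s" for s
  proof (rule LIMSEQ_I)
    fix e :: real
    assume "e > 0"
    then obtain k where k: "\<And>s. \<bar>x k s - q s\<bar> \<le> e / 2"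
      using close[of e] unfolding eventually_sequentially by blast
    \<comment> \<open>One iterate close to \<open>q\<close> suffices, because the distance to a
      fixed point never grows afterwards.\<close>
    have "\<bar>x n s - q s\<bar> \<le> e / 2" if "n \<ge> k" for n s
      using that
    proof (induction n arbitrary: s rule: dec_induct)
      case base
      show ?case by (rule k)
    next
      case (step n)
      then show ?case
        using step_fixpoint_dist[OF q] by blast
    qed
    moreover have "e / 2 < e"
      using \<open>e > 0\<close> by simp
    ultimately show "\<exists>no. \<forall>n\<ge>no. norm (x n s - q s) < e"
      unfolding real_norm_def by (meson le_less_trans)
  qed
  with q show ?thesis
    by (rule that)
qed

end

section \<open>Stochastic matrices\<close>

definition stochastic :: "('s::finite \<Rightarrow> 's \<Rightarrow> real) \<Rightarrow> bool" where
  "stochastic M \<longleftrightarrow> (\<forall>s. (\<forall>u. M s u \<ge> 0) \<and> (\<Sum>u\<in>UNIV. M s u) = 1)"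

lemma stochastic_nonneg: "stochastic M \<Longrightarrow> M s u \<ge> 0"
  and stochastic_sum: "stochastic M \<Longrightarrow> (\<Sum>u\<in>UNIV. M s u) = 1"
  by (auto simp: stochastic_def)

lemma mvec_add: "mvec M (\<lambda>s. v s + w s) = (\<lambda>s. mvec M v s + mvec M w s)"
  by (simp add: mvec_def fun_eq_iff distrib_left sum.distrib)

lemma mvec_diff: "mvec M (\<lambda>s. v s - w s) = (\<lambda>s. mvec M v s - mvec M w s)"
  by (simp add: mvec_def fun_eq_iff right_diff_distrib sum_subtractf)

lemma mvec_const: "stochastic M \<Longrightarrow> mvec M (\<lambda>_. c) = (\<lambda>_. c)"
  by (simp add: mvec_def fun_eq_iff stochastic_sum flip: sum_distrib_right)

lemma mvec_mono:
  assumes "stochastic M" "\<And>s. v s \<le> w s"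
  shows "mvec M v s \<le> mvec M w s"
  unfolding mvec_def using assms by (intro sum_mono mult_left_mono stochastic_nonneg)

lemma mvec_abs_le:
  assumes "stochastic M" "\<And>s. \<bar>v s\<bar> \<le> c"
  shows "\<bar>mvec M v s\<bar> \<le> c"
proof -
  have "v s \<le> c" "- c \<le> v s" for s
    using assms(2)[of s] by auto
  then have "mvec M v s \<le> c" "- c \<le> mvec M v s"
    using mvec_mono[OF assms(1), of v "\<lambda>_. c" s] mvec_mono[OF assms(1), of "\<lambda>_. - c" v s]
    by (simp_all add: mvec_const[OF assms(1)])
  then show ?thesis
    by simp
qed

lemma mpow_add: "mpow M (m + n) s u = (\<Sum>v\<in>UNIV. mpow M m s v * mpow M n v u)"
proof (induction m arbitrary: s)
  case 0
  have "(\<Sum>v\<in>UNIV. mpow M 0 s v * mpow M n v u) = (\<Sum>v\<in>UNIV. if s = v then mpow M n v u else 0)"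
    by (rule sum.cong) auto
  then show ?case
    by simp
next
  case (Suc m)
  have "mpow M (Suc m + n) s u = (\<Sum>w\<in>UNIV. \<Sum>v\<in>UNIV. M s w * (mpow M m w v * mpow M n v u))"
    by (simp add: Suc sum_distrib_left)
  also have "\<dots> = (\<Sum>v\<in>UNIV. \<Sum>w\<in>UNIV. M s w * (mpow M m w v * mpow M n v u))"
    by (rule sum.swap)
  also have "\<dots> = (\<Sum>v\<in>UNIV. mpow M (Suc m) s v * mpow M n v u)"
    by (simp add: sum_distrib_right mult.assoc)
  finally show ?case .
qed

lemma mpow_1: "mpow M (Suc 0) = M"
proof (intro ext)
  fix s u
  have "(\<Sum>v\<in>UNIV. M s v * (if v = u then 1 else 0)) = (\<Sum>v\<in>UNIV. if v = u then M s v else 0)"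
    by (rule sum.cong) auto
  then show "mpow M (Suc 0) s u = M s u"
    by simp
qed

lemma mvec_mpow_0: "mvec (mpow M 0) v = v"
proof
  fix s
  have "(\<Sum>u\<in>UNIV. mpow M 0 s u * v u) = (\<Sum>u\<in>UNIV. if s = u then v u else 0)"
    by (rule sum.cong) auto
  then show "mvec (mpow M 0) v s = v s"
    by (simp add: mvec_def)
qed

text \<open>The recursion of \<open>mpow\<close> peels a factor off on the left; this peels it off
  on the right, next to the vector, as the telescoping of rewards requires.\<close>

lemma mvec_mpow_Suc: "mvec (mpow M (Suc t)) v = mvec (mpow M t) (mvec M v)"
proof
  fix s
  have "mpow M (Suc t) s u = (\<Sum>w\<in>UNIV. mpow M t s w * M w u)" for u
    using mpow_add[of M t "Suc 0" s u] unfolding mpow_1 by simp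
  then have "mvec (mpow M (Suc t)) v s = (\<Sum>u\<in>UNIV. \<Sum>w\<in>UNIV. mpow M t s w * M w u * v u)"
    by (simp add: mvec_def sum_distrib_right del: mpow.simps)
  also have "\<dots> = (\<Sum>w\<in>UNIV. \<Sum>u\<in>UNIV. mpow M t s w * M w u * v u)"
    by (rule sum.swap)
  also have "\<dots> = mvec (mpow M t) (mvec M v) s"
    by (simp add: mvec_def sum_distrib_left mult.assoc)
  finally show "mvec (mpow M (Suc t)) v s = mvec (mpow M t) (mvec M v) s" .
qed

lemma stochastic_mpow:
  assumes "stochastic M"
  shows "stochastic (mpow M t)"
proof (induction t)
  case 0
  then show ?case
    by (simp add: stochastic_def)
next
  case (Suc t)
  have "mvec (mpow M (Suc t)) (\<lambda>_. 1) s = 1" for s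
    by (simp only: mvec_mpow_Suc mvec_const[OF assms] mvec_const[OF Suc])
  then have "(\<Sum>u\<in>UNIV. mpow M (Suc t) s u) = 1" for s
    by (simp add: mvec_def)
  moreover have "mpow M (Suc t) s u \<ge> 0" for s u
    by (simp add: sum_nonneg stochastic_nonneg[OF assms] stochastic_nonneg[OF Suc])
  ultimately show ?case
    unfolding stochastic_def by blast
qed

text \<open>Passing through \<open>v\<close> at time \<open>m\<close> is one nonnegative term of the
  Chapman-Kolmogorov sum.\<close>

lemma mpow_mult_le:
  assumes "stochastic M"
  shows "mpow M m s v * mpow M n v u \<le> mpow M (m + n) s u"
  unfolding mpow_add using stochastic_mpow[OF assms]
  by (intro member_le_sum) (auto intro: mult_nonneg_nonneg stochastic_nonneg)

section \<open>Closed sets and transience\<close>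

definition closed_set :: "('s \<Rightarrow> 's \<Rightarrow> real) \<Rightarrow> 's set \<Rightarrow> bool" where
  "closed_set M A \<longleftrightarrow> (\<forall>s\<in>A. \<forall>u. M s u > 0 \<longrightarrow> u \<in> A)"

lemma closed_set_mpow:
  assumes "stochastic M" "closed_set M A" "s \<in> A" "mpow M t s u > 0"
  shows "u \<in> A"
  using assms(3,4)
proof (induction t arbitrary: s)
  case 0
  then show ?case
    by (simp split: if_splits)
next
  case (Suc t)
  from Suc.prems(2) have "(\<Sum>w\<in>UNIV. M s w * mpow M t w u) \<noteq> 0"
    by simp
  then obtain w where "M s w * mpow M t w u \<noteq> 0"
    by (meson sum.neutral)
  then have "M s w > 0" "mpow M t w u > 0"
    using stochastic_nonneg[OF assms(1), of s w]
      stochastic_nonneg[OF stochastic_mpow[OF assms(1)], of t w u] by auto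
  then show ?case
    using Suc.IH[of w] Suc.prems(1) assms(2) by (auto simp: closed_set_def)
qed

lemma closed_set_reachable:
  assumes "stochastic M"
  shows "closed_set M {v. \<exists>t. mpow M t s v > 0}"
  unfolding closed_set_def
proof (intro ballI allI impI CollectI)
  fix v u
  assume "v \<in> {v. \<exists>t. mpow M t s v > 0}" and vu: "M v u > 0"
  then obtain t where t: "mpow M t s v > 0"
    by blast
  have "0 < mpow M t s v * mpow M (Suc 0) v u"
    unfolding mpow_1 using t vu by simp
  also have "\<dots> \<le> mpow M (t + Suc 0) s u"
    by (rule mpow_mult_le[OF assms])
  finally show "\<exists>t. mpow M t s u > 0"
    by blast
qed

lemma closed_set_sum_mpow:
  assumes "stochastic M" "closed_set M A" "s \<in> A"
  shows "(\<Sum>u\<in>A. mpow M t s u) = 1"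
proof -
  have "mpow M t s u = 0" if "u \<notin> A" for u
    using closed_set_mpow[OF assms] stochastic_nonneg[OF stochastic_mpow[OF assms(1)], of t s u] that
    by (metis less_eq_real_def)
  then have "(\<Sum>u\<in>A. mpow M t s u) = (\<Sum>u\<in>UNIV. mpow M t s u)"
    by (intro sum.mono_neutral_left) auto
  then show ?thesis
    using stochastic_sum[OF stochastic_mpow[OF assms(1)]] by simp
qed

text \<open>In an inclusion-minimal closed set all states communicate. If they were all transient, the
  columns of the powers would be summable there, although each row sums to 1.\<close>

lemma closed_set_not_all_transient:
  assumes M: "stochastic M" and "closed_set M A" "A \<noteq> {}"
  shows "\<exists>s\<in>A. \<not> transient M s"
proof -
  define K where "K = {B. B \<subseteq> A \<and> B \<noteq> {} \<and> closed_set M B}"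
  have "finite K" "A \<in> K"
    using assms(2,3) by (simp_all add: K_def)
  then obtain B where B: "B \<in> K" and min: "\<And>B'. B' \<in> K \<Longrightarrow> B' \<subseteq> B \<Longrightarrow> B' = B"
    using finite_has_minimal2[of K A] by metis
  then have cl: "closed_set M B" and "B \<noteq> {}" and BA: "B \<subseteq> A"
    by (auto simp: K_def)
  then obtain s where s: "s \<in> B"
    by blast
  \<comment> \<open>The states reachable from \<open>u\<close> form a nonempty closed subset of
    \<open>B\<close>, so by minimality all of \<open>B\<close>, including \<open>s\<close>.\<close>
  have comm: "\<exists>n. mpow M n u s > 0" if u: "u \<in> B" for u
  proof -
    let ?R = "{v. \<exists>t. mpow M t u v > 0}"
    have "mpow M 0 u u > 0"
      by simp
    then have "u \<in> ?R"
      by blast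
    moreover have "?R \<subseteq> B"
      using closed_set_mpow[OF M cl u] by blast
    ultimately have "?R = B"
      using closed_set_reachable[OF M, of u] BA by (intro min) (auto simp: K_def)
    then show ?thesis
      using s by blast
  qed
  show ?thesis
  proof (rule ccontr)
    assume "\<not> ?thesis"
    then have tr: "summable (\<lambda>t. mpow M t u u)" if "u \<in> B" for u
      using that BA by (auto simp: transient_def)
    have "summable (\<lambda>t. mpow M t s u)" if u: "u \<in> B" for u
    proof -
      obtain n where n: "mpow M n u s > 0"
        using comm[OF u] by blast
      \<comment> \<open>Going from \<open>u\<close> to \<open>s\<close> in \<open>n\<close> steps
        and back in \<open>t\<close> steps is a return to \<open>u\<close>, so the diagonal series
        at \<open>u\<close> dominates.\<close>
      have "summable (\<lambda>t. mpow M (n + t) u u / mpow M n u s)"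
        using summable_ignore_initial_segment[OF tr[OF u], of n]
        by (intro summable_divide) (simp add: add.commute)
      then show ?thesis
      proof (rule summable_comparison_test'[where N = 0])
        fix t
        have "mpow M t s u \<le> mpow M (n + t) u u / mpow M n u s"
          using mpow_mult_le[OF M, of n u s t u] n by (simp add: field_simps)
        then show "norm (mpow M t s u) \<le> mpow M (n + t) u u / mpow M n u s"
          using stochastic_nonneg[OF stochastic_mpow[OF M], of t s u] by simp
      qed
    qed
    then have "summable (\<lambda>t. \<Sum>u\<in>B. mpow M t s u)"
      by (rule summable_sum)
    then show False
      by (simp add: closed_set_sum_mpow[OF M cl s] summable_const_iff)
  qed
qed

text \<open>The maximum principle: where \<open>g\<close> equals its upper bound \<open>c\<close>,
  the average of the nonnegative \<open>c - g\<close> over successors is at most 0, so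
  \<open>g = c\<close> at each successor of positive probability.\<close>

lemma closed_set_argmax:
  assumes M: "stochastic M" and sub: "\<And>s. g s \<le> mvec M g s" and max: "\<And>s. g s \<le> c"
  shows "closed_set M {s. g s = c}"
  unfolding closed_set_def
proof (intro ballI allI impI)
  fix s u
  assume s: "s \<in> {s. g s = c}" and su: "M s u > 0"
  have "mvec M (\<lambda>u. c - g u) s = c - mvec M g s"
    by (simp add: mvec_diff mvec_const[OF M])
  also have "\<dots> \<le> 0"
    using sub[of s] s by simp
  finally have "(\<Sum>u\<in>UNIV. M s u * (c - g u)) \<le> 0"
    by (simp add: mvec_def)
  moreover have "M s u * (c - g u) \<le> (\<Sum>u\<in>UNIV. M s u * (c - g u))"
    using max by (intro member_le_sum) (auto intro: mult_nonneg_nonneg stochastic_nonneg[OF M])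
  ultimately have "M s u * (c - g u) \<le> 0"
    by linarith
  then have "c - g u \<le> 0"
    using su by (simp add: mult_le_0_iff)
  then show "u \<in> {s. g s = c}"
    using max[of u] by simp
qed

section \<open>Bellman operators\<close>

definition q_val :: "('s::finite \<Rightarrow> 'a \<Rightarrow> 's \<Rightarrow> real) \<Rightarrow> ('s \<Rightarrow> 'a \<Rightarrow> real) \<Rightarrow> ('s \<Rightarrow> real) \<Rightarrow> 's \<Rightarrow> 'a \<Rightarrow> real"
  where "q_val P r v s a = r s a + (\<Sum>s'\<in>UNIV. P s a s' * v s')"

lemma stochastic_P_pol:
  assumes "is_mdp P" "\<pi> \<in> policies"
  shows "stochastic (P_pol P \<pi>)"
proof -
  have "(\<Sum>s'\<in>UNIV. P_pol P \<pi> s s') = 1" for s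
  proof -
    have "(\<Sum>s'\<in>UNIV. P_pol P \<pi> s s') = (\<Sum>a\<in>UNIV. \<Sum>s'\<in>UNIV. \<pi> s a * P s a s')"
      unfolding P_pol_def by (rule sum.swap)
    also have "\<dots> = 1"
      using assms by (simp add: is_mdp_def policies_def flip: sum_distrib_left)
    finally show ?thesis .
  qed
  moreover have "P_pol P \<pi> s s' \<ge> 0" for s s'
    using assms by (auto simp: P_pol_def is_mdp_def policies_def intro!: sum_nonneg)
  ultimately show ?thesis
    by (simp add: stochastic_def)
qed

lemma det_pol_policy: "det_pol d \<in> policies"
  by (simp add: policies_def det_pol_def)

lemma det_pol_sum:
  fixes d :: "'s \<Rightarrow> 'a::finite"
  shows "(\<Sum>a\<in>UNIV. det_pol d s a * x a) = x (d s)"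
proof -
  have "(\<Sum>a\<in>UNIV. det_pol d s a * x a) = (\<Sum>a\<in>UNIV. if a = d s then x a else 0)"
    by (rule sum.cong) (auto simp: det_pol_def)
  then show ?thesis
    by simp
qed

lemma P_pol_det: "P_pol P (det_pol d) s = P s (d s)"
  by (simp add: P_pol_def det_pol_sum fun_eq_iff)

lemma T_pol_det: "T_pol P r (det_pol d) v s = q_val P r v s (d s)"
  by (simp add: T_pol_def r_pol_def det_pol_sum P_pol_det mvec_def q_val_def)

lemma q_val_le_T_bell: "q_val P r v s a \<le> T_bell P r v s"
  unfolding T_bell_def q_val_def by (rule Max_ge) auto

lemma T_bell_attained: "\<exists>a. T_bell P r v s = q_val P r v s a"
proof -
  have "T_bell P r v s \<in> range (q_val P r v s)"
    unfolding T_bell_def q_val_def[abs_def] by (rule Max_in) auto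
  then show ?thesis
    by auto
qed

lemma T_bell_greedy: "\<exists>d. T_pol P r (det_pol d) v = T_bell P r v"
proof -
  have "\<forall>s. \<exists>a. T_bell P r v s = q_val P r v s a"
    by (simp add: T_bell_attained)
  then obtain d where "\<forall>s. T_bell P r v s = q_val P r v s (d s)"
    by (rule choice[THEN exE])
  then have "T_pol P r (det_pol d) v = T_bell P r v"
    by (simp add: T_pol_det fun_eq_iff)
  then show ?thesis
    by blast
qed

lemma q_val_diff: "q_val P r u s a - q_val P r v s a = mvec (\<lambda>s. P s a) (\<lambda>s. u s - v s) s"
  by (simp add: q_val_def mvec_def right_diff_distrib sum_subtractf)

lemma stochastic_action: "is_mdp P \<Longrightarrow> stochastic (\<lambda>s. P s a)"
  by (simp add: is_mdp_def stochastic_def)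

text \<open>A maximizing action for \<open>u\<close> is a competitor for \<open>v\<close> and
  conversely, while for a fixed action the values differ by an average of
  \<open>u - v\<close>.\<close>

lemma T_bell_nonexpansive:
  assumes "is_mdp P" "\<And>s. \<bar>u s - v s\<bar> \<le> c"
  shows "\<bar>T_bell P r u s - T_bell P r v s\<bar> \<le> c"
proof -
  have *: "\<bar>q_val P r u s a - q_val P r v s a\<bar> \<le> c" for a
    unfolding q_val_diff by (rule mvec_abs_le[OF stochastic_action[OF assms(1)] assms(2)])
  obtain a b where "T_bell P r u s = q_val P r u s a" "T_bell P r v s = q_val P r v s b"
    using T_bell_attained by metis
  then show ?thesis
    using *[of a] *[of b] q_val_le_T_bell[of P r u s b] q_val_le_T_bell[of P r v s a]
    by linarith
qed

text \<open>Transition probabilities sum to 1, so a constant passes through every action value. This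
  is what permits shifting the iterates.\<close>

lemma T_bell_shift:
  assumes "is_mdp P"
  shows "T_bell P r (\<lambda>s. v s + c) s = T_bell P r v s + c"
proof -
  have *: "q_val P r (\<lambda>s. v s + c) s a = q_val P r v s a + c" for a
    using assms by (simp add: q_val_def is_mdp_def distrib_left sum.distrib flip: sum_distrib_right)
  obtain a b where "T_bell P r v s = q_val P r v s a"
    "T_bell P r (\<lambda>s. v s + c) s = q_val P r (\<lambda>s. v s + c) s b"
    using T_bell_attained by metis
  then show ?thesis
    using * q_val_le_T_bell[of P r v s b] q_val_le_T_bell[of P r "\<lambda>s. v s + c" s a]
    by (auto intro: order_antisym)
qed

section \<open>Gains\<close>

text \<open>Writing the reward of \<open>\<pi>\<close> as \<open>T\<^sup>\<pi> v - P\<^sup>\<pi> v\<close>, the expected total reward telescopes up to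
  the average of the residual.\<close>

lemma gain_bounds:
  assumes P: "is_mdp P" and \<pi>: "\<pi> \<in> policies"
    and res: "\<And>s. \<bar>T_pol P r \<pi> v s - v s - c\<bar> \<le> e"
  shows "\<bar>gain P r \<pi> s - c\<bar> \<le> e"
proof -
  let ?M = "P_pol P \<pi>"
  note M = stochastic_P_pol[OF P \<pi>]
  note Mt = stochastic_mpow[OF M]
  define w where "w = (\<lambda>s. T_pol P r \<pi> v s - v s - c)"
  define avg where "avg = (\<lambda>T. 1 / real T * (\<Sum>t<T. mvec (mpow ?M t) (r_pol r \<pi>) s))"
  obtain B where B: "\<And>s. \<bar>v s\<bar> \<le> B"
  proof
    show "\<bar>v s\<bar> \<le> Max (range (\<lambda>s. \<bar>v s\<bar>))" for s
      by (rule Max_ge) auto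
  qed
  have "r_pol r \<pi> = (\<lambda>s. (c + w s) + (v s - mvec ?M v s))"
    by (simp add: w_def T_pol_def fun_eq_iff)
  then have step: "mvec (mpow ?M t) (r_pol r \<pi>) s = c + mvec (mpow ?M t) w s +
      (mvec (mpow ?M t) v s - mvec (mpow ?M (Suc t)) v s)" for t
    by (simp only: mvec_add mvec_diff mvec_const[OF Mt] mvec_mpow_Suc)
  have tel: "(\<Sum>t<T. mvec (mpow ?M t) (r_pol r \<pi>) s) =
      real T * c + (\<Sum>t<T. mvec (mpow ?M t) w s) + (v s - mvec (mpow ?M T) v s)" for T
    unfolding step sum.distrib sum_lessThan_telescope'[of "\<lambda>t. mvec (mpow ?M t) v s" T]
    by (simp add: mvec_mpow_0 del: mpow.simps)
  have "\<bar>mvec (mpow ?M t) w s\<bar> \<le> e" for t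
    using res unfolding w_def by (rule mvec_abs_le[OF Mt])
  then have "\<bar>\<Sum>t<T. mvec (mpow ?M t) w s\<bar> \<le> (\<Sum>t<T. e)" for T
    by (intro order_trans[OF sum_abs] sum_mono)
  then have sum_w: "\<bar>\<Sum>t<T. mvec (mpow ?M t) w s\<bar> \<le> real T * e" for T
    by simp
  have bdry: "\<bar>v s - mvec (mpow ?M T) v s\<bar> \<le> 2 * B" for T
  proof -
    have "\<bar>mvec (mpow ?M T) v s\<bar> \<le> B"
      by (rule mvec_abs_le[OF Mt]) (rule B)
    then show ?thesis
      using B[of s] by linarith
  qed
  have avg: "\<bar>avg T - c\<bar> \<le> e + 2 * B / real T" if "T > 0" for T
  proof -
    have "avg T - c = ((\<Sum>t<T. mvec (mpow ?M t) w s) + (v s - mvec (mpow ?M T) v s)) / real T"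
      using that by (simp only: avg_def tel) (simp add: field_simps)
    also have "\<bar>\<dots>\<bar> \<le> (real T * e + 2 * B) / real T"
      using sum_w[of T] bdry[of T] that by (simp add: divide_right_mono)
    also have "\<dots> = e + 2 * B / real T"
      using that by (simp add: field_simps)
    finally show ?thesis .
  qed
  have ev: "\<forall>\<^sub>F T in sequentially. c - (e + 2 * B / real T) \<le> avg T \<and> avg T \<le> c + (e + 2 * B / real T)"
    using eventually_gt_at_top[of 0]
  proof eventually_elim
    case (elim T)
    show ?case
      using avg[OF elim] by linarith
  qed
  have lim0: "(\<lambda>T. 2 * B / real T) \<longlonglongrightarrow> 0"
    by (rule lim_const_over_n)
  have "(\<lambda>T. ereal (c - (e + 2 * B / real T))) \<longlonglongrightarrow> ereal (c - (e + 0))"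
    by (intro tendsto_intros lim0)
  then have "liminf (\<lambda>T. ereal (c - (e + 2 * B / real T))) = ereal (c - (e + 0))"
    by (rule lim_imp_Liminf[OF sequentially_bot])
  then have "ereal (c - e) = liminf (\<lambda>T. ereal (c - (e + 2 * B / real T)))"
    by simp
  also have "\<dots> \<le> liminf (\<lambda>T. ereal (avg T))"
    using ev by (intro Liminf_mono) (auto elim!: eventually_mono)
  finally have lower: "ereal (c - e) \<le> liminf (\<lambda>T. ereal (avg T))" .
  have "(\<lambda>T. ereal (c + (e + 2 * B / real T))) \<longlonglongrightarrow> ereal (c + (e + 0))"
    by (intro tendsto_intros lim0)
  then have lim: "liminf (\<lambda>T. ereal (c + (e + 2 * B / real T))) = ereal (c + (e + 0))"
    by (rule lim_imp_Liminf[OF sequentially_bot])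
  have "liminf (\<lambda>T. ereal (avg T)) \<le> liminf (\<lambda>T. ereal (c + (e + 2 * B / real T)))"
    using ev by (intro Liminf_mono) (auto elim!: eventually_mono)
  also have "\<dots> = ereal (c + e)"
    using lim by simp
  finally have upper: "liminf (\<lambda>T. ereal (avg T)) \<le> ereal (c + e)" .
  have "gain P r \<pi> s = real_of_ereal (liminf (\<lambda>T. ereal (avg T)))"
    by (simp add: gain_def avg_def)
  \<comment> \<open>Both bounds are finite, so the extended liminf is a real number and
    \<open>real_of_ereal\<close> returns its true value.\<close>
  then show ?thesis
    using lower upper by (cases "liminf (\<lambda>T. ereal (avg T))") auto
qed

text \<open>The minimum of a superharmonic \<open>g\<close> is absorbing under every action, its maximum under a policy
  preserving \<open>g\<close>. Both sets contain a nontransient state, hence meet \<open>C\<close>, and some policy leads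
  from the first intersection to the second.\<close>

lemma weakly_communicating_const:
  assumes P: "is_mdp P" and wc: "weakly_communicating P"
    and super: "\<And>s a. (\<Sum>s'\<in>UNIV. P s a s' * g s') \<le> g s"
    and \<pi>: "\<pi> \<in> policies" "mvec (P_pol P \<pi>) g = g"
  shows "\<exists>c. g = (\<lambda>_. c)"
proof -
  obtain C where comm: "\<forall>s\<in>C. \<forall>s'\<in>C. \<exists>d. \<exists>t. mpow (P_pol P (det_pol d)) t s s' > 0"
    and trans: "\<forall>s. s \<notin> C \<longrightarrow> (\<forall>\<rho>\<in>policies. transient (P_pol P \<rho>) s)"
    using wc unfolding weakly_communicating_def by (elim exE conjE) (rule that)
  have meets: "A \<inter> C \<noteq> {}"
    if "\<rho> \<in> policies" "closed_set (P_pol P \<rho>) A" "A \<noteq> {}" for A \<rho>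
    using closed_set_not_all_transient[OF stochastic_P_pol[OF P that(1)] that(2,3)] trans that(1)
    by blast
  define m where "m = Min (range g)"
  have m: "m \<le> g s" for s
    unfolding m_def by (rule Min_le) auto
  define N where "N = Max (range g)"
  have N: "g s \<le> N" for s
    unfolding N_def by (rule Max_ge) auto
  have "m \<in> range g"
    unfolding m_def by (rule Min_in) auto
  moreover have "N \<in> range g"
    unfolding N_def by (rule Max_in) auto
  ultimately have ne: "{s. g s = m} \<noteq> {}" "{s. g s = N} \<noteq> {}"
    by auto
  \<comment> \<open>The maximum principle is applied to \<open>- g\<close>, which is subharmonic
    under every deterministic policy.\<close>
  have cl_min: "closed_set (P_pol P (det_pol d)) {s. g s = m}" for d
  proof -
    have "closed_set (P_pol P (det_pol d)) {s. - g s = - m}"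
    proof (rule closed_set_argmax)
      show "- g s \<le> mvec (P_pol P (det_pol d)) (\<lambda>s. - g s) s" for s
        using super[where s = s and a = "d s"] by (simp add: mvec_def P_pol_det sum_negf)
    qed (use m stochastic_P_pol[OF P det_pol_policy] in auto)
    then show ?thesis
      by simp
  qed
  have "closed_set (P_pol P \<pi>) {s. g s = N}"
    using \<pi>(2) N by (intro closed_set_argmax stochastic_P_pol[OF P \<pi>(1)]) (auto simp: fun_eq_iff)
  from meets[OF \<pi>(1) this ne(2)] obtain z where z: "z \<in> C" "g z = N"
    by blast
  from meets[OF det_pol_policy cl_min ne(1)] obtain y where y: "y \<in> C" "g y = m"
    by blast
  obtain d t where "mpow (P_pol P (det_pol d)) t y z > 0"
    using comm y(1) z(1) by blast
  \<comment> \<open>The path from \<open>y\<close> cannot leave the set where \<open>g\<close> is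
    minimal, so \<open>z\<close> attains both extremes of \<open>g\<close>.\<close>
  from closed_set_mpow[OF stochastic_P_pol[OF P det_pol_policy] cl_min _ this] y(2)
  have "g z = m"
    by blast
  then have "g s = m" for s
    using m[of s] N[of s] z(2) by simp
  then show ?thesis
    by blast
qed

lemma mod_bellman_gain_const:
  assumes "is_mdp P" "weakly_communicating P" "mod_bellman P r g h"
  shows "\<exists>c. g = (\<lambda>_. c)"
proof -
  obtain \<pi> where \<pi>: "\<pi> \<in> policies" "mvec (P_pol P \<pi>) g = g"
    using assms(3) by (auto simp: mod_bellman_def fun_eq_iff)
  have "(\<Sum>s'\<in>UNIV. P s a s' * g s') \<le> g s" for s a
  proof -
    have "(\<Sum>s'\<in>UNIV. P s a s' * g s') \<le> Max (range (\<lambda>a. \<Sum>s'\<in>UNIV. P s a s' * g s'))"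
      by (rule Max_ge) auto
    also have "\<dots> = g s"
      using assms(3) unfolding mod_bellman_def by blast
    finally show ?thesis .
  qed
  then show ?thesis
    using weakly_communicating_const[OF assms(1,2) _ \<pi>] by blast
qed

text \<open>With a constant gain the first equation is automatic and every policy attains it, so a
  greedy policy attains both maxima.\<close>

lemma mod_bellman_constI:
  assumes P: "is_mdp P" and sol: "\<And>s. T_bell P r h s = h s + c"
  shows "mod_bellman P r (\<lambda>_. c) h"
proof -
  obtain d where d: "T_pol P r (det_pol d) h = T_bell P r h"
    using T_bell_greedy by metis
  have "(\<Sum>s'\<in>UNIV. P s a s' * c) = c" for s a
    using P by (simp add: is_mdp_def flip: sum_distrib_right)
  moreover have "mvec (P_pol P (det_pol d)) (\<lambda>_. c) s = c" for s
    by (simp add: mvec_const[OF stochastic_P_pol[OF P det_pol_policy]])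
  ultimately show ?thesis
    unfolding mod_bellman_def using sol det_pol_policy[of d] d
    by (auto simp: T_bell_def fun_eq_iff intro!: bexI[of _ "det_pol d"])
qed

section \<open>Relative value iteration\<close>

lemma abs_le_supn: "\<bar>v s\<bar> \<le> supn v"
  unfolding supn_def by (rule Max_ge) auto

lemma supn_le: "(\<And>s. \<bar>v s\<bar> \<le> c) \<Longrightarrow> supn v \<le> c"
  unfolding supn_def by (subst Max_le_iff) auto

text \<open>The topology of a function type is the product topology, so convergence is
  coordinatewise.\<close>

lemma tendsto_fun:
  fixes x :: "'b \<Rightarrow> 'i \<Rightarrow> 'a::topological_space"
  assumes "\<And>i. ((\<lambda>k. x k i) \<longlongrightarrow> l i) F"
  shows "(x \<longlongrightarrow> l) F"
proof -
  have "limitin (product_topology (\<lambda>_. euclidean) UNIV) x l F"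
    using assms by (simp add: limitin_componentwise)
  then show ?thesis
    by (simp add: euclidean_product_topology)
qed

text \<open>Each step halves the error of \<open>a\<close> and adds half the error of
  \<open>b\<close>. Once the latter is below \<open>e / 2\<close>, the bound \<open>e / 2\<close>
  plus a geometric term reproduces itself.\<close>

lemma averaged_recursion_tendsto:
  fixes a b :: "nat \<Rightarrow> real"
  assumes step: "\<And>k. a (Suc k) = (a k + b k) / 2" and "b \<longlonglongrightarrow> L"
  shows "a \<longlonglongrightarrow> L"
proof (rule LIMSEQ_I)
  fix e :: real
  assume e: "e > 0"
  then obtain K where K: "\<And>k. k \<ge> K \<Longrightarrow> \<bar>b k - L\<bar> < e / 2"
    using LIMSEQ_D[OF assms(2), of "e / 2"] by auto
  have bound: "\<bar>a (n + K) - L\<bar> \<le> e / 2 + \<bar>a K - L\<bar> * (1 / 2) ^ n" for n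
  proof (induction n)
    case 0
    then show ?case
      using e by simp
  next
    case (Suc n)
    have *: "a (Suc n + K) - L = ((a (n + K) - L) + (b (n + K) - L)) / 2"
      by (simp add: step field_simps)
    have "\<bar>a (Suc n + K) - L\<bar> \<le> (\<bar>a (n + K) - L\<bar> + \<bar>b (n + K) - L\<bar>) / 2"
      unfolding * using abs_triangle_ineq[of "a (n + K) - L" "b (n + K) - L"]
      by (simp only: abs_divide abs_numeral) (simp add: divide_right_mono)
    then show ?case
      using Suc K[of "n + K"] by simp
  qed
  have "(\<lambda>n. e / 2 + \<bar>a K - L\<bar> * (1 / 2) ^ n) \<longlonglongrightarrow> e / 2 + \<bar>a K - L\<bar> * 0"
    by (intro tendsto_intros LIMSEQ_power_zero) simp
  then have "\<forall>\<^sub>F n in sequentially. e / 2 + \<bar>a K - L\<bar> * (1 / 2) ^ n < e"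
    by (rule order_tendstoD) (use e in simp)
  then have "\<forall>\<^sub>F n in sequentially. norm (a (n + K) - L) < e"
  proof eventually_elim
    case (elim n)
    then show ?case
      using bound[of n] by simp
  qed
  then have "\<forall>\<^sub>F n in sequentially. norm (a n - L) < e"
    using eventually_sequentially_seg[of "\<lambda>n. norm (a n - L) < e" K] by blast
  then show "\<exists>no. \<forall>n\<ge>no. norm (a n - L) < e"
    by (simp add: eventually_sequentially)
qed

theorem theorem5:
  fixes P :: "'s::finite \<Rightarrow> 'a::finite \<Rightarrow> 's \<Rightarrow> real"
    and r :: "'s \<Rightarrow> 'a \<Rightarrow> real"
    and hstar :: "'s \<Rightarrow> real"
    and f :: "('s \<Rightarrow> real) \<Rightarrow> real"
    and h :: "nat \<Rightarrow> 's \<Rightarrow> real"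
  assumes mdp: "is_mdp P"
    and wc: "weakly_communicating P"
    and sol: "mod_bellman P r (opt_gain P r) hstar"
    and f_cont: "continuous_on UNIV f"
    and f_shift: "\<And>x c. f (\<lambda>s. x s + c) = f x + c"
    and h_rec: "\<And>k. h (Suc k) = (\<lambda>s. 1/2 * h k s + 1/2 * (T_bell P r (h k) s - f (h k)))"
  shows "(\<forall>k\<ge>1. \<forall>\<pi>\<in>policies. T_pol P r \<pi> (h k) = T_bell P r (h k) \<longrightarrow>
            supn (\<lambda>s. opt_gain P r s - gain P r \<pi> s)
              \<le> supn (\<lambda>s. T_bell P r (h k) s - h k s - opt_gain P r s) \<and>
            supn (\<lambda>s. T_bell P r (h k) s - h k s - opt_gain P r s)
              \<le> 4 / sqrt (pi * real k) * supn (\<lambda>s. h 0 s - hstar s))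
       \<and> (\<exists>hinf. mod_bellman P r (opt_gain P r) hinf \<and> h \<longlonglongrightarrow> hinf \<and>
            (\<lambda>k. (\<lambda>s. f (h k))) \<longlonglongrightarrow> opt_gain P r)"

proof -
  obtain c where c: "opt_gain P r = (\<lambda>_. c)"
    using mod_bellman_gain_const[OF mdp wc sol] by blast
  define F where "F = (\<lambda>v s. T_bell P r v s - c)"
  \<comment> \<open>Increments of \<open>(f (h k) - c) / 2\<close> replace the correction
    \<open>f (h k)\<close> in the recursion by the constant \<open>c\<close>; starting from 0 keeps
    \<open>x 0 = h 0\<close>.\<close>
  define off where "off = (\<lambda>k. (\<Sum>i<k. f (h i) - c) / 2)"
  define x where "x = (\<lambda>k s. h k s + off k)"
  have off_Suc: "off (Suc k) = off k + (f (h k) - c) / 2" for k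
    by (simp add: off_def add_divide_distrib)
  have Tx: "T_bell P r (x k) s = T_bell P r (h k) s + off k" for k s
    unfolding x_def by (rule T_bell_shift[OF mdp])
  \<comment> \<open>Residuals do not change under scalar shifts, so bounds for \<open>x\<close> are
    bounds for \<open>h\<close>.\<close>
  have residual: "F (x k) s - x k s = T_bell P r (h k) s - h k s - opt_gain P r s" for k s
    unfolding F_def Tx c by (simp add: x_def)
  interpret km_iteration F x hstar "supn (\<lambda>s. h 0 s - hstar s)"
  proof
    show "sup_nonexpansive F"
      unfolding sup_nonexpansive_def F_def using T_bell_nonexpansive[OF mdp] by simp
    show "F hstar = hstar"
      using sol by (simp add: F_def fun_eq_iff mod_bellman_def T_bell_def c)
    show "x (Suc k) s = (x k s + F (x k) s) / 2" for k s
      unfolding F_def Tx by (simp add: x_def off_Suc h_rec field_simps)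
    show "\<bar>x 0 s - hstar s\<bar> \<le> supn (\<lambda>s. h 0 s - hstar s)" for s
      using abs_le_supn[of "\<lambda>s. h 0 s - hstar s" s] by (simp add: x_def off_def)
  qed
  have "supn (\<lambda>s. opt_gain P r s - gain P r \<pi> s)
      \<le> supn (\<lambda>s. T_bell P r (h k) s - h k s - opt_gain P r s)"
    if "\<pi> \<in> policies" "T_pol P r \<pi> (h k) = T_bell P r (h k)" for k \<pi>
  proof (rule supn_le)
    let ?e = "supn (\<lambda>s. T_bell P r (h k) s - h k s - opt_gain P r s)"
    have "\<bar>T_pol P r \<pi> (h k) s - h k s - c\<bar> \<le> ?e" for s
      using abs_le_supn[of "\<lambda>s. T_bell P r (h k) s - h k s - opt_gain P r s" s]
      by (simp add: that c)
    from gain_bounds[OF mdp that(1) this]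
    show "\<bar>opt_gain P r s - gain P r \<pi> s\<bar> \<le> ?e" for s
      unfolding c by (simp add: abs_minus_commute)
  qed
  moreover have "supn (\<lambda>s. T_bell P r (h k) s - h k s - opt_gain P r s)
      \<le> 4 / sqrt (pi * real k) * supn (\<lambda>s. h 0 s - hstar s)" if "k \<ge> 1" for k
    using residual_le[of k] that by (intro supn_le) (simp add: residual)
  moreover have "\<exists>hinf. mod_bellman P r (opt_gain P r) hinf \<and> h \<longlonglongrightarrow> hinf \<and>
      (\<lambda>k. (\<lambda>s. f (h k))) \<longlonglongrightarrow> opt_gain P r"
  proof -
    obtain q where q: "F q = q" and lim: "\<And>s. (\<lambda>k. x k s) \<longlonglongrightarrow> q s"
      using converges_to_fixpoint by blast
    have Tq: "T_bell P r q s = q s + c" for s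
      using fun_cong[OF q, of s] by (simp add: F_def)
    have "x \<longlonglongrightarrow> q"
      by (rule tendsto_fun) (rule lim)
    then have fx: "(\<lambda>k. f (x k)) \<longlonglongrightarrow> f q"
      by (intro continuous_on_tendsto_compose[OF f_cont]) auto
    have f_h: "f (x k) = f (h k) + off k" for k
      unfolding x_def by (rule f_shift)
    have off_lim: "off \<longlonglongrightarrow> f q - c"
    proof (rule averaged_recursion_tendsto)
      \<comment> \<open>Substituting \<open>f (h k) = f (x k) - off k\<close> exposes the
        contraction factor 1/2, driven by a convergent sequence.\<close>
      show "off (Suc k) = (off k + (f (x k) - c)) / 2" for k
        by (simp add: off_Suc f_h field_simps)
    qed (intro tendsto_intros fx)
    \<comment> \<open>The limit of the shifts is subtracted from \<open>q\<close>; the optimality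
      equation is invariant under constants.\<close>
    define hinf where "hinf = (\<lambda>s. q s + - (f q - c))"
    have "T_bell P r hinf s = hinf s + c" for s
      unfolding hinf_def T_bell_shift[OF mdp] Tq by simp
    then have "mod_bellman P r (opt_gain P r) hinf"
      unfolding c by (rule mod_bellman_constI[OF mdp])
    moreover have "h \<longlonglongrightarrow> hinf"
    proof (rule tendsto_fun)
      have "(\<lambda>k. x k s + - off k) \<longlonglongrightarrow> hinf s" for s
        unfolding hinf_def by (intro tendsto_intros lim off_lim)
      then show "(\<lambda>k. h k s) \<longlonglongrightarrow> hinf s" for s
        by (simp add: x_def)
    qed
    moreover have "(\<lambda>k. (\<lambda>s. f (h k))) \<longlonglongrightarrow> opt_gain P r"
    proof (rule tendsto_fun)
      have "(\<lambda>k. f (x k) - off k) \<longlonglongrightarrow> f q - (f q - c)"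
        by (intro tendsto_intros fx off_lim)
      then show "(\<lambda>k. f (h k)) \<longlonglongrightarrow> opt_gain P r s" for s
        by (simp add: f_h c)
    qed
    ultimately show ?thesis
      by blast
  qed
  ultimately show ?thesis
    by blast
qed

end
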